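(* For every integer $n\ge 1$, $$\lambda_n = - n \sum_{j=1}^n \frac{(-1)^j}{j}\binom{n+j-1}{2j-1}\, Z(j).$$
   Context: Let $\zeta$ be the Riemann zeta function. Its nontrivial zeros $\rho$ (counted with multiplicity) are listed in pairs $\{\rho,1-\rho\}$ as $\rho=\tfrac12\pm \mathrm{i}\tau_k$, $k=1,2,\ldots$, with $\{\operatorname{Re}\tau_k\}$ positive and non-decreasing. (The Riemann Hypothesis is not assumed, so the $\tau_k$ may be complex.) Each pair is parametrized by the single number $x_k=\rho(1-\rho)=\tfrac14+\tau_k^2$. All sums and products over zeros are performed with $\rho$ and $1-\rho$ paired together. The Li coefficients are $\lambda_n=\sum_\rho\bigl[1-(1-1/\rho)^n\bigr]$ for $n\ge1$, where the sum is over all nontrivial zeros. Explicitly, it is the sum over $k$ of the two terms for $\rho=\tfrac12+\mathrm{i}\tau_k$ and $\rho=\tfrac12-\mathrm{i}\tau_k$. Equivalently, near $z=0$, $$\frac{d}{dz}\log\Xi\Bigl(\frac1{1-z}\Bigr)=\sum_{n\ge1}\lambda_n z^{n-1},\qquad \Xi(s)=s(s-1)\Gamma(s/2)\pi^{-s/2}\zeta(s).$$ The secondary zeta function is $Z(\sigma)=\sum_{k=1}^\infty x_k^{-\sigma}$ for $\operatorname{Re}\sigma>\tfrac12$. *)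

theory Defs
  imports "HOL-Complex_Analysis.Complex_Analysis"
begin

(* The analytic continuation is unique on - {1}; its value at the pole 1 is unspecified
   and is never used below. *)
definition riemann_zeta :: "complex \<Rightarrow> complex" where
  "riemann_zeta = (SOME f. f holomorphic_on (- {1}) \<and>
     (\<forall>s. Re s > 1 \<longrightarrow> (\<lambda>m. of_nat (Suc m) powr (- s)) sums f s))"

definition nontrivial_zeta_zero :: "complex \<Rightarrow> bool" where
  "nontrivial_zeta_zero \<rho> \<longleftrightarrow> riemann_zeta \<rho> = 0 \<and> 0 < Re \<rho> \<and> Re \<rho> < 1"

(* The sequence is indexed from 0, so that tau k here is the mathematical tau_{k+1}.
   The last conjunct says that the points 1/2 + i tau_k and 1/2 - i tau_k, taken over all k,
   run through the nontrivial zeros, each as often as its multiplicity.  The set counted there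
   is forced to be finite, since card would be 0 otherwise and the multiplicity is positive. *)
definition zeta_zero_listing :: "(nat \<Rightarrow> complex) \<Rightarrow> bool" where
  "zeta_zero_listing \<tau> \<longleftrightarrow>
     (\<forall>k. 0 < Re (\<tau> k)) \<and>
     mono (\<lambda>k. Re (\<tau> k)) \<and>
     (\<forall>k. nontrivial_zeta_zero (1/2 + \<i> * \<tau> k) \<and> nontrivial_zeta_zero (1/2 - \<i> * \<tau> k)) \<and>
     (\<forall>\<rho>. nontrivial_zeta_zero \<rho> \<longrightarrow>
        zorder riemann_zeta \<rho> =
          int (card {(k, \<epsilon>). \<epsilon> \<in> {1, -1} \<and> 1/2 + \<epsilon> * \<i> * \<tau> k = \<rho>}))"

definition li_coeff :: "(nat \<Rightarrow> complex) \<Rightarrow> nat \<Rightarrow> complex" where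
  "li_coeff \<tau> n =
     (\<Sum>k. (1 - (1 - 1 / (1/2 + \<i> * \<tau> k)) ^ n) + (1 - (1 - 1 / (1/2 - \<i> * \<tau> k)) ^ n))"

definition secondary_zeta :: "(nat \<Rightarrow> complex) \<Rightarrow> complex \<Rightarrow> complex" where
  "secondary_zeta \<tau> \<sigma> = (\<Sum>k. (1/4 + (\<tau> k)\<^sup>2) powr (- \<sigma>))"

end

theory Submission
  imports Defs
begin

text \<open>
  Put \<open>u = 1 - 1/\<rho>\<close>.  Then \<open>1 - 1/(1 - \<rho>) = 1/u\<close> and \<open>u + 1/u = 2 - 1/x\<close> with \<open>x = \<rho>(1 - \<rho>)\<close>, so
  \<open>u^n + u^-n\<close> is a Chebyshev-type polynomial in \<open>1/x\<close>, a sum of two consecutive Morgan-Voyce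
  polynomials.  This gives the identity for each pair of zeros.

  Exchanging the two sums needs the convergence of \<open>\<Sum> 1/\<bar>x\<^sub>k\<bar>\<close>, where \<open>\<bar>x\<^sub>k\<bar> \<ge> (Re \<tau>\<^sub>k)^2\<close>.  Since
  \<open>(s - 1) \<zeta>(s)\<close> grows quadratically on \<open>Re s \<ge> 1/10\<close> and is bounded away from 0 on \<open>Re s = 2\<close>,
  Jensen's argument on discs around \<open>2 + i T\<close> bounds the number of zeros with real part at least
  1/2 and imaginary part within 1/2 of \<open>T\<close> by \<open>O(sqrt (4 + \<bar>T\<bar>))\<close>, which suffices.
\<close>

section \<open>The identity for one pair of zeros\<close>

text \<open>The Morgan-Voyce polynomial b_n at -y. For y = 2 - u - 1/u with u other than -1 it
  equals (u^(n+1) + u^(-n)) / (u + 1), which is why two consecutive ones add up to a power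
  sum.\<close>

definition morgan_voyce :: "complex \<Rightarrow> nat \<Rightarrow> complex" where
  "morgan_voyce y n = (\<Sum>j\<le>n. (-1)^j * of_nat ((n+j) choose (2*j)) * y^j)"

lemma morgan_voyce_extend:
  "m \<ge> n \<Longrightarrow> morgan_voyce y n = (\<Sum>j\<le>m. (-1)^j * of_nat ((n+j) choose (2*j)) * y^j)"
  unfolding morgan_voyce_def by (rule sum.mono_neutral_left) (auto intro!: binomial_eq_0)

text \<open>Pascal's rule applied twice; this is the three-term recurrence below, read
  coefficientwise.\<close>

lemma binomial_second_difference:
  "((m + 2) choose (k + 2)) + (m choose (k+2)) = 2 * ((m+1) choose (k+2)) + (m choose k)"
  by (simp add: numeral_2_eq_2)

lemma morgan_voyce_rec: "morgan_voyce y (n + 2) = (2 - y) * morgan_voyce y (n + 1) - morgan_voyce y n"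
proof -
  have s: "(\<Sum>j\<le>n+2. f j) = f 0 + (\<Sum>j\<le>n+1. f (Suc j))" for f :: "nat \<Rightarrow> complex"
    by (simp only: sum.atMost_Suc_shift add_2_eq_Suc' Suc_eq_plus1[symmetric])
  have *: "of_nat ((n+2+Suc j) choose (2*Suc j)) + of_nat ((n+Suc j) choose (2*Suc j)) =
     2 * of_nat ((n+1+Suc j) choose (2*Suc j)) + (of_nat ((n+1+j) choose (2*j)) :: complex)" for j
  proof -
    have "((n+2+Suc j) choose (2*Suc j)) + ((n+Suc j) choose (2*Suc j)) =
     2 * ((n+1+Suc j) choose (2*Suc j)) + ((n+1+j) choose (2*j))"
      using binomial_second_difference[of "n+1+j" "2*j"] by (simp add: algebra_simps)
    from arg_cong[OF this, of "of_nat :: nat \<Rightarrow> complex"] show ?thesis by simp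
  qed
  have "morgan_voyce y (n+2) + morgan_voyce y n - 2 * morgan_voyce y (n+1) =
     (\<Sum>j\<le>n+2. (-1)^j * (of_nat ((n+2+j) choose (2*j)) + of_nat ((n+j) choose (2*j))
        - 2 * of_nat ((n+1+j) choose (2*j))) * y^j)"
    by (subst morgan_voyce_extend[of n "n+2"], simp, subst morgan_voyce_extend[of "n+1" "n+2"], simp,
        subst morgan_voyce_def)
       (simp only: sum_distrib_left sum.distrib[symmetric] sum_subtractf[symmetric],
        intro sum.cong, simp_all only: algebra_simps)
  \<comment> \<open>The constant term drops out, its coefficient being 1 + 1 - 2; the shift from j
    to \<open>Suc j\<close> produces the factor -y.\<close>
  also have "\<dots> = (\<Sum>j\<le>n+1. (-1)^Suc j * (of_nat ((n+1+j) choose (2*j))) * y^Suc j)"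
    unfolding s * by simp
  also have "\<dots> = - y * morgan_voyce y (n+1)"
    unfolding morgan_voyce_def sum_distrib_left by (intro sum.cong refl) simp
  finally show ?thesis by (simp add: algebra_simps)
qed

text \<open>Both sides obey w(n+2) = (2 - y) w(n+1) - w(n), so agreement at n = 0 and n = 1
  suffices.\<close>

lemma power_sum_reciprocal_morgan_voyce:
  assumes "u * v = 1" "u + v = 2 - y"
  shows "u ^ Suc n + v ^ Suc n = morgan_voyce y (Suc n) + morgan_voyce y n"
proof (induction n rule: less_induct)
  case (less n)
  consider "n = 0" | "n = 1" | m where "n = m + 2"
    by (metis One_nat_def add_2_eq_Suc' nat.exhaust)
  then show ?case
  proof cases
    case 1
    then show ?thesis using assms by (simp add: morgan_voyce_def numeral_2_eq_2)
  next
    case 2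
    have "u\<^sup>2 + v\<^sup>2 = (u+v)\<^sup>2 - 2 * (u * v)" by (simp add: power2_eq_square algebra_simps)
    then show ?thesis unfolding 2 assms using morgan_voyce_rec[of y 0]
      by (simp add: morgan_voyce_def numeral_2_eq_2 power2_eq_square algebra_simps)
  next
    case (3 m)
    have "u ^ (m+3) + v ^ (m+3) = (u + v) * (u^(m+2) + v^(m+2)) - (u * v) * (u^(m+1) + v^(m+1))"
      by (simp add: algebra_simps eval_nat_numeral)
    also have "\<dots> = (2 - y) * (morgan_voyce y (m+2) + morgan_voyce y (m+1)) - (morgan_voyce y (m+1) + morgan_voyce y m)"
      unfolding assms using less[of "m+1"] less[of m] 3 by simp
    also have "\<dots> = ((2 - y) * morgan_voyce y (m+1+1) - morgan_voyce y (m+1)) +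
        ((2 - y) * morgan_voyce y (m+1) - morgan_voyce y m)"
      by (simp add: algebra_simps)
    also have "\<dots> = morgan_voyce y (m+3) + morgan_voyce y (m+2)"
      unfolding morgan_voyce_rec[symmetric] by (simp add: eval_nat_numeral)
    finally show ?thesis by (simp add: 3 eval_nat_numeral)
  qed
qed

text \<open>With N = n+j-1 and k = 2j-1, Pascal turns the bracket into C(N,k) + 2 C(N,k+1), and
  absorption (k+1) C(N,k+1) = (N-k) C(N,k) collapses it, as N-k+j = n. For j > n both sides
  vanish.\<close>

lemma binomial_li_coefficient:
  assumes "1 \<le> j" "1 \<le> n"
  shows "n * ((n + j - 1) choose (2*j-1)) = j * (((n+j) choose (2*j)) + ((n-1+j) choose (2*j)))"
proof (cases "j \<le> n")
  case True
  obtain i m where im: "j = Suc i" "n = Suc m" using assms by (metis Suc_le_D One_nat_def)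
  define N where "N = m + Suc i"
  define k where "k = 2*i+1"
  have nj: "N - k + j = n" "N \<ge> k" using True unfolding N_def k_def im by auto
  have a: "(Suc N choose Suc k) = (N choose k) + (N choose Suc k)" by simp
  have b: "Suc k * (N choose Suc k) = (N - k) * (N choose k)"
    by (simp only: binomial_absorb_comp binomial_absorption)
  have "2 * (n * (N choose k)) = 2 * (j * ((N choose k) + 2 * (N choose Suc k)))"
  proof -
    have k: "Suc k = 2 * j" unfolding k_def im by simp
    have "2 * (j * ((N choose k) + 2 * (N choose Suc k))) = 2 * j * (N choose k) + 2 * (Suc k * (N choose Suc k))"
      unfolding k by (simp add: algebra_simps)
    also have "\<dots> = 2 * (N - k + j) * (N choose k)" unfolding b by (simp add: algebra_simps)
    finally show ?thesis unfolding nj by simp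
  qed
  moreover have "n + j = Suc N" "n + j - 1 = N" "n - 1 + j = N" "2 * j = Suc k" "2 * j - 1 = k"
    unfolding N_def k_def im by auto
  ultimately show ?thesis using a by (simp del: binomial_Suc_Suc)
next
  case False
  then show ?thesis using assms by (simp add: binomial_eq_0)
qed

lemma li_term_eq:
  fixes \<rho> :: complex
  assumes "\<rho> \<noteq> 0" "\<rho> \<noteq> 1" "n \<ge> 1"
  shows "(1 - (1 - 1 / \<rho>) ^ n) + (1 - (1 - 1 / (1 - \<rho>)) ^ n) =
    (\<Sum>j=1..n. - of_nat n * ((-1) ^ j / of_nat j * of_nat ((n + j - 1) choose (2 * j - 1)) *
        (1 / (\<rho> * (1 - \<rho>))) ^ j))"
proof -
  define y where "y = 1 / (\<rho> * (1 - \<rho>))"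
  have uv: "(1 - 1 / \<rho>) * (1 - 1 / (1 - \<rho>)) = 1" "(1 - 1 / \<rho>) + (1 - 1 / (1 - \<rho>)) = 2 - y"
    using assms unfolding y_def by (auto simp: field_simps)
  obtain m where n: "n = Suc m" using assms by (cases n) auto
  have m: "morgan_voyce y m = (\<Sum>j\<le>n. (-1)^j * of_nat ((n-1+j) choose (2*j)) * y^j)"
    by (subst morgan_voyce_extend[of m n]) (auto simp: n)
  have s: "{..n} = insert 0 {1..n}" by auto
  have c: "(-1)^j / of_nat j * of_nat n * of_nat ((n + j - 1) choose (2 * j - 1)) =
     (-1)^j * of_nat ((n+j) choose (2*j)) + (-1)^j * (of_nat ((n-1+j) choose (2*j)) :: complex)"
    if "j \<in> {1..n}" for j
  proof -
    have "of_nat n * of_nat ((n + j - 1) choose (2 * j - 1)) =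
      of_nat j * (of_nat ((n+j) choose (2*j)) + (of_nat ((n-1+j) choose (2*j)) :: complex))"
      using that assms
      by (simp only: of_nat_mult[symmetric] of_nat_add[symmetric] binomial_li_coefficient[of j n] atLeastAtMost_iff)
    then show ?thesis using that
      by (simp add: divide_simps distrib_left[symmetric] mult.assoc)
  qed
  have "(1 - 1 / \<rho>) ^ n + (1 - 1 / (1 - \<rho>)) ^ n = morgan_voyce y n + morgan_voyce y m"
    unfolding n by (rule power_sum_reciprocal_morgan_voyce[OF uv])
  \<comment> \<open>The two terms with j = 0 are both 1; their sum 2 cancels the two ones of the Li
    summand.\<close>
  also have "\<dots> = 2 + (\<Sum>j=1..n. ((-1)^j * of_nat ((n+j) choose (2*j)) + (-1)^j * of_nat ((n-1+j) choose (2*j))) * y^j)"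
    unfolding m unfolding morgan_voyce_def s by (simp add: sum.distrib algebra_simps)
  also have "\<dots> = 2 + (\<Sum>j=1..n. (-1)^j / of_nat j * of_nat n * of_nat ((n + j - 1) choose (2 * j - 1)) * y^j)"
    by (intro arg_cong2[of _ _ _ _ "(+)"] sum.cong refl, subst c) auto
  finally show ?thesis unfolding y_def[symmetric]
    by (simp add: sum_negf algebra_simps)
qed

section \<open>Counting zeros in a disc\<close>

text \<open>Zeros are divided out one at a time: removing a linear factor lowers the order at that
  point by exactly one, so the multiplicity bound survives the induction. It is an inequality
  because later only one zero of each pair is selected.\<close>

lemma holomorphic_factor_zeros:
  fixes \<rho> :: "'i \<Rightarrow> complex"
  assumes "finite I" "open S" "connected S" "g holomorphic_on S" "\<exists>w\<in>S. g w \<noteq> 0"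
    and "\<And>i. i \<in> I \<Longrightarrow> \<rho> i \<in> S"
    and "\<And>z. z \<in> S \<Longrightarrow> int (card {i \<in> I. \<rho> i = z}) \<le> zorder g z"
  shows "\<exists>h. h holomorphic_on S \<and> (\<forall>s\<in>S. g s = h s * (\<Prod>i\<in>I. s - \<rho> i))"
  using assms
proof (induction I arbitrary: g rule: finite_induct)
  case empty
  then show ?case by auto
next
  case (insert j I)
  define a where "a = \<rho> j"
  have aS: "a \<in> S" using insert.prems unfolding a_def by auto
  have ev: "\<forall>\<^sub>F w in at z. g w \<noteq> 0" if "z \<in> S" for z
  proof -
    obtain w where "w \<in> S" "g w \<noteq> 0" using insert.prems(4) by blast
    from non_zero_neighbour_alt[OF insert.prems(3,1,2) that this] show ?thesis
      by (rule eventually_mono) simp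
  qed
  \<comment> \<open>The index j itself is counted, so the order at a is positive and a is a
    zero.\<close>
  have "card {i \<in> insert j I. \<rho> i = a} > 0"
    using insert.hyps by (subst card_gt_0_iff) (auto simp: a_def)
  then have "zorder g a > 0" using insert.prems(6)[OF aS] by linarith
  then have g0: "g a = 0"
    using zorder_pos_iff[OF insert.prems(3,1) aS] eventually_frequently[OF _ ev[OF aS]] by simp
  define k where "k = (\<lambda>z. if z = a then deriv g a else (g z - g a) / (z - a))"
  have k: "k holomorphic_on S" unfolding k_def
    by (rule pole_lemma_open) fact+
  have gk: "g s = (s - a) * k s" for s unfolding k_def using g0 by auto
  have kz: "zorder g z = zorder k z + (if z = a then 1 else 0)" if z: "z \<in> S" for z
  proof -
    have "zorder g z = zorder (\<lambda>s. (s - a) * k s) z"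
      by (intro arg_cong2[of _ _ _ _ zorder] ext gk refl)
    also have "\<dots> = zorder (\<lambda>s. s - a) z + zorder k z"
    proof (rule zorder_times_analytic)
      show "k analytic_on {z}" using k z insert.prems(1) analytic_at by blast
      show "\<forall>\<^sub>F s in at z. (s - a) * k s \<noteq> 0" using ev[OF z] unfolding gk .
    qed (auto intro!: analytic_intros)
    also have "zorder (\<lambda>s. s - a) z = (if z = a then 1 else 0)"
    proof (cases "z = a")
      case True
      have "zorder (\<lambda>s. s - a) a = 1"
        by (rule zorder_eqI[of UNIV _ "\<lambda>_. 1"]) auto
      then show ?thesis using True by simp
    next
      case False
      then show ?thesis by (auto intro!: zorder_eq_0I analytic_intros)
    qed
    finally show ?thesis by simp
  qed
  have "\<exists>h. h holomorphic_on S \<and> (\<forall>s\<in>S. k s = h s * (\<Prod>i\<in>I. s - \<rho> i))"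
  proof (rule insert.IH)
    show "\<exists>w\<in>S. k w \<noteq> 0" using insert.prems(4) unfolding gk by auto
    fix z assume z: "z \<in> S"
    have "{i \<in> insert j I. \<rho> i = z} = (if z = a then insert j {i \<in> I. \<rho> i = z} else {i \<in> I. \<rho> i = z})"
      by (auto simp: a_def)
    then have "int (card {i \<in> insert j I. \<rho> i = z}) = int (card {i \<in> I. \<rho> i = z}) + (if z = a then 1 else 0)"
      using insert.hyps by auto
    then show "int (card {i \<in> I. \<rho> i = z}) \<le> zorder k z"
      using insert.prems(6)[OF z] kz[OF z] by linarith
  qed (use insert.prems k in auto)
  then obtain h where "h holomorphic_on S" "\<forall>s\<in>S. k s = h s * (\<Prod>i\<in>I. s - \<rho> i)" by blast
  then show ?case using insert.hyps by (intro exI[of _ h]) (auto simp: gk a_def)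
qed

text \<open>On the circle R^2 = (s - z) * cnj (s - z), so the numerator is (s - z) * cnj (s - a), of
  modulus R |s - a|.\<close>

lemma norm_reflected_factor:
  fixes a s z :: complex
  assumes "dist z s = R" "R > 0"
  shows "norm ((of_real (R\<^sup>2) - cnj (a - z) * (s - z)) / of_real R) = norm (s - a)"
proof -
  have "norm (s - z) = R" using assms by (simp add: dist_norm norm_minus_commute)
  then have s: "(s - z) * cnj (s - z) = of_real (R\<^sup>2)"
    using complex_norm_square[of "s - z"] by simp
  have "of_real (R\<^sup>2) - cnj (a - z) * (s - z) = (s - z) * cnj (s - a)"
    unfolding s[symmetric] by (simp add: algebra_simps)
  then have "norm ((of_real (R\<^sup>2) - cnj (a - z) * (s - z)) / of_real R)
      = norm (s - z) * norm (cnj (s - a)) / norm (of_real R :: complex)"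
    by (simp only: norm_mult norm_divide)
  also have "norm (cnj (s - a)) = norm (s - a)" by (rule complex_mod_cnj)
  finally show ?thesis using \<open>norm (s - z) = R\<close> assms by simp
qed

text \<open>The factors of \<open>g\<close> that vanish at \<open>\<rho> i\<close> are replaced by their reflections in the circle of
  radius \<open>R\<close>, which have the same modulus on that circle but are large at the centre.\<close>
lemma jensen_zero_count:
  fixes \<rho> :: "'i \<Rightarrow> complex"
  assumes "finite I" "open S" "connected S" "g holomorphic_on S" "cball z R \<subseteq> S"
    and gz: "g z \<noteq> 0" and r: "0 < r" "r < R"
    and \<rho>: "\<And>i. i \<in> I \<Longrightarrow> dist z (\<rho> i) \<le> r"
    and "\<And>z. z \<in> S \<Longrightarrow> int (card {i \<in> I. \<rho> i = z}) \<le> zorder g z"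
    and M: "\<And>s. dist z s = R \<Longrightarrow> norm (g s) \<le> M"
  shows "norm (g z) * (R / r) ^ card I \<le> M"
proof -
  have zS: "z \<in> S" using assms by auto
  have "\<exists>h. h holomorphic_on S \<and> (\<forall>s\<in>S. g s = h s * (\<Prod>i\<in>I. s - \<rho> i))"
  proof (rule holomorphic_factor_zeros)
    show "\<exists>w\<in>S. g w \<noteq> 0" using gz zS by blast
    show "\<rho> i \<in> S" if "i \<in> I" for i
      using \<rho>[OF that] r assms(5) by (intro subsetD[OF assms(5)]) auto
  qed fact+
  then obtain h where h: "h holomorphic_on S" "\<And>s. s \<in> S \<Longrightarrow> g s = h s * (\<Prod>i\<in>I. s - \<rho> i)"
    by blast
  define F where "F = (\<lambda>s. h s * (\<Prod>i\<in>I. (of_real (R\<^sup>2) - cnj (\<rho> i - z) * (s - z)) / of_real R))"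
  have F: "F holomorphic_on S" unfolding F_def using r
    by (intro holomorphic_intros h) auto
  \<comment> \<open>By the maximum modulus principle it is enough to bound F on the circle, where
    |F| = |g|.\<close>
  have le: "norm (F z) \<le> M"
  proof (rule maximum_modulus_frontier[of F "cball z R"])
    show "F holomorphic_on interior (cball z R)"
      using F by (rule holomorphic_on_subset) (use assms(5) interior_subset in blast)
    show "continuous_on (closure (cball z R)) F"
      using F assms(5) by (simp add: holomorphic_on_imp_continuous_on holomorphic_on_subset)
    fix s assume "s \<in> frontier (cball z R)"
    then have s: "dist z s = R" using r by (simp add: sphere_def)
    have "norm (F s) = norm (h s) * (\<Prod>i\<in>I. norm (s - \<rho> i))"
      unfolding F_def norm_mult prod_norm[symmetric]
      by (subst norm_reflected_factor[OF s]) (use r in auto)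
    also have "\<dots> = norm (g s)"
      using h(2)[of s] s assms(5) by (auto simp: norm_mult prod_norm)
    finally show "norm (F s) \<le> M" using M[OF s] by simp
  qed (use r in auto)
  \<comment> \<open>At the centre every reflected factor equals R, while |z -
    \<open>\<rho> i\<close>| is at most r: each zero gains a factor R / r.\<close>
  have "norm (g z) * (R / r) ^ card I = norm (h z) * ((\<Prod>i\<in>I. norm (z - \<rho> i)) * (\<Prod>i\<in>I. R / r))"
    using h(2)[OF zS] by (simp add: norm_mult prod_norm)
  also have "(\<Prod>i\<in>I. norm (z - \<rho> i)) * (\<Prod>i\<in>I. R / r) = (\<Prod>i\<in>I. norm (z - \<rho> i) * (R / r))"
    by (rule prod.distrib[symmetric])
  also have "norm (h z) * \<dots> \<le> norm (h z) * (\<Prod>i\<in>I. R)"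
  proof (intro mult_left_mono prod_mono conjI)
    fix i assume "i \<in> I"
    then have "norm (z - \<rho> i) \<le> r" using \<rho> by (simp add: dist_norm)
    then have "norm (z - \<rho> i) * (R / r) \<le> r * (R / r)"
      using r by (intro mult_right_mono) auto
    then show "norm (z - \<rho> i) * (R / r) \<le> R" using r by simp
  qed (use r in auto)
  also have "\<dots> = norm (F z)"
    unfolding F_def using r by (simp add: norm_mult norm_divide norm_power power2_eq_square)
  finally show ?thesis using le by simp
qed

section \<open>Analytic continuation of the zeta function\<close>

text \<open>The Taylor remainder of \<open>x powr (1 - s)\<close> at \<open>x = n + 2\<close>, expanded around \<open>n + 1\<close>.  Summing over \<open>n\<close>,
  the leading terms telescope and the others are multiples of \<open>\<zeta>(s), \<zeta>(s + 1), \<dots>\<close>.\<close>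
definition taylor_term :: "nat \<Rightarrow> nat \<Rightarrow> complex \<Rightarrow> complex" where
  "taylor_term N n s = of_nat (n + 2) powr (1 - s)
     - (\<Sum>i\<le>N. ((1 - s) gchoose i) * of_nat (Suc n) powr (1 - s - of_nat i))"

text \<open>Taylor's theorem on the segment from n + 1 to n + 2. The assumption on Re s makes the
  modulus of the derivative of order N + 1 non-increasing there, so the left end gives the bound;
  \<open>Suc N\<close> is (N+1)! / N!.\<close>

lemma norm_taylor_term_le:
  assumes "Re s \<ge> - real N"
  shows "norm (taylor_term N n s) \<le>
    real (Suc N) * norm ((1 - s) gchoose Suc N) * real (Suc n) powr (- Re s - real N)"
proof -
  define a where "a = 1 - s"
  define S :: "complex set" where "S = closed_segment (of_nat (Suc n)) (of_nat (n + 2))"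
  \<comment> \<open>\<open>f i\<close> is the i-th derivative of \<open>x powr a\<close>, as i!
    times \<open>a gchoose i\<close> is the falling factorial.\<close>
  define f where "f = (\<lambda>i x. fact i * (a gchoose i) * x powr (a - of_nat i))"
  define B where "B = fact (Suc N) * norm (a gchoose Suc N) * real (Suc n) powr (- Re s - real N)"
  have S: "\<exists>t. x = of_real t \<and> t \<ge> real (Suc n)" if x: "x \<in> S" for x
  proof -
    have "x \<in> complex_of_real ` closed_segment (real (Suc n)) (real (n + 2))"
      using x closed_segment_of_real[of "real (Suc n)" "real (n + 2)", where ?'a = complex]
      unfolding S_def by simp
    then show ?thesis by (auto simp: closed_segment_eq_real_ivl)
  qed
  have fact_gbinomial: "fact (Suc i) * (a gchoose Suc i) = (a - of_nat i) * (fact i * (a gchoose i))" for i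
    by (simp only: gbinomial_mult_fact prod.atLeast0_lessThan_Suc mult.commute)
  have "norm (f 0 (of_nat (n + 2)) - (\<Sum>i\<le>N. f i (of_nat (Suc n)) * (of_nat (n + 2) - of_nat (Suc n)) ^ i / fact i))
      \<le> B * norm (of_nat (n + 2) - of_nat (Suc n) :: complex) ^ Suc N / fact N"
  proof (rule complex_Taylor[of S])
    show "convex S" "of_nat (Suc n) \<in> S" "of_nat (n + 2) \<in> S" unfolding S_def by auto
  next
    fix i x assume "x \<in> S"
    then have "x \<notin> \<real>\<^sub>\<le>\<^sub>0" using S[of x] by auto
    from has_field_derivative_powr[OF this, of "a - of_nat i"]
    have "((\<lambda>x. fact i * (a gchoose i) * x powr (a - of_nat i)) has_field_derivative
       fact i * (a gchoose i) * ((a - of_nat i) * x powr (a - of_nat i - 1))) (at x within S)"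
      by (intro DERIV_cmult) (auto intro: has_field_derivative_at_within)
    moreover have "fact i * (a gchoose i) * ((a - of_nat i) * x powr (a - of_nat i - 1)) = f (Suc i) x"
      unfolding f_def fact_gbinomial by (simp add: algebra_simps)
    ultimately show "(f i has_field_derivative f (Suc i) x) (at x within S)"
      unfolding f_def by simp
  next
    fix x assume "x \<in> S"
    then obtain t where t: "x = of_real t" "t \<ge> real (Suc n)" using S by blast
    have "norm (x powr (a - of_nat (Suc N))) = t powr (- Re s - real N)"
      using t by (subst norm_powr_real_powr) (auto simp: a_def)
    also have "\<dots> \<le> real (Suc n) powr (- Re s - real N)"
      using t assms by (intro powr_mono2') auto
    finally show "norm (f (Suc N) x) \<le> B"
      unfolding f_def B_def norm_mult by (intro mult_mono) (auto simp del: fact_Suc)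
  qed
  also have "f 0 (of_nat (n + 2)) - (\<Sum>i\<le>N. f i (of_nat (Suc n)) * (of_nat (n + 2) - of_nat (Suc n)) ^ i / fact i)
      = taylor_term N n s"
    unfolding f_def taylor_term_def a_def by simp
  finally show ?thesis unfolding B_def a_def by simp
qed

lemma holomorphic_on_gbinomial [holomorphic_intros]:
  assumes "f holomorphic_on A"
  shows "(\<lambda>s. f s gchoose k) holomorphic_on A"
  using assms unfolding gbinomial_prod_rev by (intro holomorphic_intros) auto

lemma summable_Suc_powr: "p < -1 \<Longrightarrow> summable (\<lambda>n. real (Suc n) powr p)"
  using summable_Suc_iff[of "\<lambda>n. real n powr p"] summable_real_powr_iff[of p] by simp

lemma open_Re_gt: "open {s. Re s > c}" and connected_Re_gt: "connected {s. Re s > c}"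
  using open_halfspace_Re_gt convex_connected[OF convex_halfspace_Re_gt] by auto

text \<open>Local Weierstrass M-test: a summable majorant near each point permits termwise
  differentiation.\<close>

lemma holomorphic_series:
  assumes "open S" "\<And>n. f n holomorphic_on S"
    and "\<And>x. x \<in> S \<Longrightarrow> \<exists>d h. 0 < d \<and> summable h \<and> (\<forall>n. \<forall>y\<in>ball x d \<inter> S. norm (f n y) \<le> h n)"
  shows "(\<lambda>s. \<Sum>n. f n s) holomorphic_on S" "s \<in> S \<Longrightarrow> summable (\<lambda>n. f n s)"
proof -
  obtain g where g: "\<forall>x \<in> S. ((\<lambda>n. f n x) sums g x) \<and> g field_differentiable (at x)"
  proof (rule series_differentiable_comparison_complex[OF assms(1), of f])
    fix n x assume "x \<in> S"
    then show "f n field_differentiable at x"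
      using assms(1,2) holomorphic_on_imp_differentiable_at by blast
  next
    fix x assume "x \<in> S"
    then obtain d h where dh: "0 < d" "summable h" "\<forall>n. \<forall>y\<in>ball x d \<inter> S. norm (f n y) \<le> h n"
      using assms(3) by blast
    have "h n \<ge> 0" for n
      using dh(1,3) \<open>x \<in> S\<close> by (meson IntI centre_in_ball norm_ge_zero order_trans)
    then show "\<exists>d h. 0 < d \<and> summable h \<and> range h \<subseteq> \<real>\<^sub>\<ge>\<^sub>0 \<and>
        (\<forall>\<^sub>F n in sequentially. \<forall>y\<in>ball x d \<inter> S. cmod (f n y) \<le> cmod (h n))"
      using dh by (intro exI[of _ d] exI[of _ "\<lambda>n. complex_of_real (h n)"])
        (auto intro!: summable_of_real simp: nonneg_Reals_def)
  qed blast
  show "s \<in> S \<Longrightarrow> summable (\<lambda>n. f n s)" using g sums_summable by blast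
  have "g holomorphic_on S"
    using g by (auto simp: holomorphic_on_def intro: field_differentiable_at_within)
  moreover have "g s = (\<Sum>n. f n s)" if "s \<in> S" for s using g that sums_unique by force
  ultimately show "(\<lambda>s. \<Sum>n. f n s) holomorphic_on S"
    by (rule holomorphic_transform)
qed

text \<open>Locally uniformly in s the remainder is O((n+1)^(-Re s - N)), a summable power when Re s
  > 1 - N.\<close>

lemma taylor_series_holomorphic:
  assumes "N > 0"
  shows "(\<lambda>s. \<Sum>n. taylor_term N n s) holomorphic_on {s. Re s > 1 - real N}" (is ?A)
    and "Re s > 1 - real N \<Longrightarrow> summable (\<lambda>n. taylor_term N n s)" (is "_ \<Longrightarrow> ?B")
proof -
  have hol: "taylor_term N n holomorphic_on {s. Re s > 1 - real N}" for n
    unfolding taylor_term_def by (intro holomorphic_intros)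
  have M: "\<exists>d h. 0 < d \<and> summable h \<and> (\<forall>n. \<forall>y\<in>ball x d \<inter> {s. Re s > 1 - real N}. norm (taylor_term N n y) \<le> h n)"
    if "x \<in> {s. Re s > 1 - real N}" for x
  proof -
    \<comment> \<open>Half the distance from x to the boundary line: on the ball of this radius the
      exponent stays at most -1 - d.\<close>
    define d where "d = (Re x - (1 - real N)) / 2"
    have d: "d > 0" using that unfolding d_def by auto
    have "continuous_on (cball x d) (\<lambda>y. (1 - y) gchoose Suc N)"
      by (intro holomorphic_on_imp_continuous_on holomorphic_intros)
    then have "bounded ((\<lambda>y. (1 - y) gchoose Suc N) ` cball x d)"
      by (intro compact_imp_bounded compact_continuous_image) auto
    then obtain C where C: "\<And>y. y \<in> cball x d \<Longrightarrow> norm ((1 - y) gchoose Suc N) \<le> C"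
      unfolding bounded_iff by blast
    have C0: "C \<ge> 0" using order_trans[OF norm_ge_zero C[of x]] d by auto
    have "summable (\<lambda>n. real (Suc N) * C * real (Suc n) powr (- 1 - d))"
      using d by (intro summable_mult summable_Suc_powr) auto
    moreover have "norm (taylor_term N n y) \<le> real (Suc N) * C * real (Suc n) powr (- 1 - d)"
      if y: "y \<in> ball x d \<inter> {s. Re s > 1 - real N}" for n y
    proof -
      have "\<bar>Re x - Re y\<bar> < d"
        using y abs_Re_le_cmod[of "x - y"] by (auto simp: dist_norm)
      then have Re: "Re y \<ge> 1 - real N + d" unfolding d_def by (auto simp: field_simps abs_if split: if_splits)
      have "norm (taylor_term N n y) \<le>
         real (Suc N) * norm ((1 - y) gchoose Suc N) * real (Suc n) powr (- Re y - real N)"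
        using Re d by (intro norm_taylor_term_le) auto
      also have "\<dots> \<le> real (Suc N) * C * real (Suc n) powr (- 1 - d)"
        using C0 C[of y] y Re by (intro mult_mono powr_mono order_refl mult_nonneg_nonneg) auto
      finally show ?thesis .
    qed
    ultimately show ?thesis using d
      by (intro exI[of _ d] exI[of _ "\<lambda>n. real (Suc N) * C * real (Suc n) powr (- 1 - d)"]) blast
  qed
  show ?A by (rule holomorphic_series(1)[OF open_Re_gt hol M])
  show ?B if "Re s > 1 - real N"
    by (rule holomorphic_series(2)[OF open_Re_gt hol M]) (use that in auto)
qed

lemma summable_dirichlet:
  assumes "Re s > 1"
  shows "summable (\<lambda>m. of_nat (Suc m) powr (- s) :: complex)"
proof (rule summable_comparison_test')
  show "summable (\<lambda>n. real (Suc n) powr (- Re s))" using assms by (intro summable_Suc_powr) auto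
qed (subst norm_powr_real_powr, auto)

definition dirichlet_zeta :: "complex \<Rightarrow> complex" where
  "dirichlet_zeta s = (\<Sum>m. of_nat (Suc m) powr (- s))"

lemma gbinomial_Suc_mult: "of_nat (Suc k) * (a gchoose Suc k) = (a - of_nat k) * (a gchoose k)"
  for a :: "'a :: field_char_0"
  using gbinomial_mult_1[of a k] by (simp add: algebra_simps)

text \<open>The leading differences telescope to -1; the summed series is then solved for its i = 1
  term (1 - s) \<zeta>(s).\<close>

lemma taylor_series_dirichlet:
  assumes s: "Re s > 1" and "N > 0"
  shows "(s - 1) * dirichlet_zeta s = 1 + (\<Sum>n. taylor_term N n s)
    - (\<Sum>i=2..N. ((1 - s) gchoose (i - 1)) / of_nat i * ((s + of_nat i - 2) * dirichlet_zeta (s + of_nat i - 1)))"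
proof -
  define z where "z = (\<lambda>i. dirichlet_zeta (s + of_nat i - 1))"
  have "(\<lambda>n. of_nat (Suc n) powr (1 - s) :: complex) \<longlonglongrightarrow> 0"
  proof (rule tendsto_norm_zero_cancel)
    have "(\<lambda>n. real (Suc n) powr (1 - Re s)) \<longlonglongrightarrow> 0"
      using s by real_asymp
    also have "(\<lambda>n. real (Suc n) powr (1 - Re s)) = (\<lambda>n. norm (of_nat (Suc n) powr (1 - s) :: complex))"
      by (intro ext, subst norm_powr_real_powr) auto
    finally show "(\<lambda>n. norm (of_nat (Suc n) powr (1 - s) :: complex)) \<longlonglongrightarrow> 0" .
  qed
  from telescope_sums[OF this]
  have t: "(\<lambda>n. of_nat (n + 2) powr (1 - s) - of_nat (Suc n) powr (1 - s)) sums (-1)" by simp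
  have "(\<lambda>n. of_nat (Suc n) powr (1 - s - of_nat i)) sums z i" if "i \<ge> 1" for i
    using summable_sums[OF summable_dirichlet[of "s + of_nat i - 1"]] s that
    unfolding z_def dirichlet_zeta_def by (simp add: algebra_simps)
  then have "(\<lambda>n. \<Sum>i=1..N. ((1 - s) gchoose i) * of_nat (Suc n) powr (1 - s - of_nat i))
      sums (\<Sum>i=1..N. ((1 - s) gchoose i) * z i)"
    by (intro sums_sum sums_mult) auto
  from sums_diff[OF t this]
  have "(\<lambda>n. of_nat (n + 2) powr (1 - s) - of_nat (Suc n) powr (1 - s) -
      (\<Sum>i=1..N. ((1 - s) gchoose i) * of_nat (Suc n) powr (1 - s - of_nat i)))
      sums (-1 - (\<Sum>i=1..N. ((1 - s) gchoose i) * z i))" .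
  also have "(\<lambda>n. of_nat (n + 2) powr (1 - s) - of_nat (Suc n) powr (1 - s) -
      (\<Sum>i=1..N. ((1 - s) gchoose i) * of_nat (Suc n) powr (1 - s - of_nat i))) = (\<lambda>n. taylor_term N n s)"
  proof
    fix n
    have "{..N} = insert 0 {1..N}" by auto
    then show "of_nat (n + 2) powr (1 - s) - of_nat (Suc n) powr (1 - s) -
      (\<Sum>i=1..N. ((1 - s) gchoose i) * of_nat (Suc n) powr (1 - s - of_nat i)) = taylor_term N n s"
      unfolding taylor_term_def by simp
  qed
  finally have "(\<Sum>n. taylor_term N n s) = -1 - (\<Sum>i=1..N. ((1 - s) gchoose i) * z i)"
    by (simp add: sums_iff)
  also have "{1..N} = insert 1 {2..N}" using assms by auto
  also have "(\<Sum>i\<in>\<dots>. ((1 - s) gchoose i) * z i) = (1 - s) * dirichlet_zeta s + (\<Sum>i=2..N. ((1 - s) gchoose i) * z i)"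
    by (subst sum.insert) (auto simp: z_def)
  also have "(\<Sum>i=2..N. ((1 - s) gchoose i) * z i) =
     - (\<Sum>i=2..N. ((1 - s) gchoose (i - 1)) / of_nat i * ((s + of_nat i - 2) * z i))"
    unfolding sum_negf[symmetric]
  proof (rule sum.cong)
    fix i assume "i \<in> {2..N}"
    then obtain k where k: "i = Suc k" by (cases i) auto
    \<comment> \<open>With i = k + 1 the factor 1 - s - k is -(s + i - 2).\<close>
    have "(1 - s) gchoose Suc k = (1 - s - of_nat k) * ((1 - s) gchoose k) / of_nat (Suc k)"
      unfolding gbinomial_Suc_mult[symmetric] by (simp del: of_nat_Suc)
    then show "((1 - s) gchoose i) * z i = - (((1 - s) gchoose (i - 1)) / of_nat i * ((s + of_nat i - 2) * z i))"
      unfolding k diff_Suc_1 by (simp only:) (simp add: algebra_simps diff_divide_distrib add_divide_distrib)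
  qed auto
  finally show ?thesis unfolding z_def by (simp add: algebra_simps)
qed

text \<open>The factor \<open>s + i - 2\<close> of the Taylor coefficient cancels the pole of \<open>\<zeta>(s + i - 1)\<close>, so the
  recursion can be run on \<open>(s - 1) * \<zeta>(s)\<close>.\<close>
lemma zeta_continuation_halfplane:
  "\<exists>g. g holomorphic_on {s. Re s > - real N} \<and> (\<forall>s. Re s > 1 \<longrightarrow> g s = (s - 1) * dirichlet_zeta s)"
proof (induction N)
  case 0
  \<comment> \<open>For order 1 the sum over i from 2 is empty, so the series alone continues (s -
    1) \<zeta>(s) to Re s > 0.\<close>
  have "(\<lambda>s. 1 + (\<Sum>n. taylor_term 1 n s)) holomorphic_on {s. Re s > 0}"
    using taylor_series_holomorphic(1)[of 1] by (intro holomorphic_intros) auto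
  then show ?case using taylor_series_dirichlet[of _ 1] by (intro exI[of _ "\<lambda>s. 1 + (\<Sum>n. taylor_term 1 n s)"]) auto
next
  case (Suc N)
  then obtain g where g: "g holomorphic_on {s. Re s > - real N}" "\<And>s. Re s > 1 \<Longrightarrow> g s = (s - 1) * dirichlet_zeta s"
    by blast
  \<comment> \<open>Order N + 2 makes the series holomorphic on Re s > -(N + 1), and for i >= 2 the
    argument s + i - 1 stays in Re > -N, where g is available.\<close>
  define G where "G = (\<lambda>s. 1 + (\<Sum>n. taylor_term (N+2) n s)
    - (\<Sum>i=2..N+2. ((1 - s) gchoose (i - 1)) / of_nat i * g (s + of_nat i - 1)))"
  have "(\<lambda>s. g (s + of_nat i - 1)) holomorphic_on {s. Re s > - real (Suc N)}" if "i \<ge> 2" for i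
  proof -
    have "g \<circ> (\<lambda>s. s + of_nat i - 1) holomorphic_on {s. Re s > - real (Suc N)}"
      by (rule holomorphic_on_compose_gen[OF _ g(1)]) (use that in \<open>auto intro!: holomorphic_intros\<close>)
    then show ?thesis by (simp add: o_def)
  qed
  then have "G holomorphic_on {s. Re s > - real (Suc N)}"
    unfolding G_def using taylor_series_holomorphic(1)[of "N+2"]
    by (intro holomorphic_intros) (auto simp: algebra_simps)
  moreover have "G s = (s - 1) * dirichlet_zeta s" if s: "Re s > 1" for s
  proof -
    have "g (s + of_nat i - 1) = (s + of_nat i - 2) * dirichlet_zeta (s + of_nat i - 1)" if "i \<ge> 2" for i
      using g(2)[of "s + of_nat i - 1"] s that by (simp add: algebra_simps)
    then show ?thesis unfolding G_def taylor_series_dirichlet[OF s, of "N+2", simplified]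
      by (auto intro!: sum.cong)
  qed
  ultimately show ?case by blast
qed

lemma zeta_continuation:
  obtains f where "f holomorphic_on - {1}" "\<And>s. Re s > 1 \<Longrightarrow> f s = dirichlet_zeta s"
proof -
  obtain g where g: "\<And>N. g N holomorphic_on {s. Re s > - real N}"
     "\<And>N s. Re s > 1 \<Longrightarrow> g N s = (s - 1) * dirichlet_zeta s"
    using zeta_continuation_halfplane by metis
  \<comment> \<open>Picks a half-plane containing s; by the identity theorem, applied in
    \<open>agree\<close>, the choice does not affect the value.\<close>
  define k where "k = (\<lambda>s. nat \<lceil>\<bar>Re s\<bar>\<rceil> + 1)"
  have k: "Re s > - real (k s)" for s unfolding k_def by linarith
  have agree: "g N s = g M s" if "Re s > - real N" "Re s > - real M" for N M s
  proof (rule analytic_continuation_open[of "{s. Re s > 1}" "{s. Re s > - real (min N M)}" "g N" "g M"])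
    show "g N holomorphic_on {s. Re s > - real (min N M)}" "g M holomorphic_on {s. Re s > - real (min N M)}"
      by (auto intro!: holomorphic_on_subset[OF g(1)])
    have "2 \<in> {s. Re s > 1}" by simp
    then show "{s. Re s > 1} \<noteq> {}" by blast
    show "g N z = g M z" if "z \<in> {s. Re s > 1}" for z using that by (simp add: g(2))
    show "{s. Re s > 1} \<subseteq> {s. Re s > - real (min N M)}" by auto
    show "s \<in> {s. Re s > - real (min N M)}" using that by auto
  qed (rule open_Re_gt connected_Re_gt)+
  define G where "G = (\<lambda>s. g (k s) s)"
  have "G holomorphic_on {s. Re s > - real N}" for N
    using g(1)[of N]
  proof (rule holomorphic_transform)
    show "g N s = G s" if "s \<in> {s. Re s > - real N}" for s
      unfolding G_def by (rule agree) (use that k in auto)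
  qed
  then have "G field_differentiable at s" for s
    by (rule holomorphic_on_imp_differentiable_at[OF _ open_Re_gt]) (use k[of s] in simp)
  then have "G holomorphic_on UNIV" by (simp add: holomorphic_on_def)
  then have "(\<lambda>s. G s / (s - 1)) holomorphic_on - {1}"
    by (intro holomorphic_intros) (auto intro: holomorphic_on_subset)
  moreover have "G s / (s - 1) = dirichlet_zeta s" if "Re s > 1" for s
    using that by (auto simp: G_def g(2))
  ultimately show ?thesis using that by blast
qed

section \<open>Zeros of the zeta function in unit boxes\<close>

text \<open>Existence of a continuation is what gives the choice in \<open>riemann_zeta\<close> its
  defining properties.\<close>

lemma riemann_zeta_holomorphic: "riemann_zeta holomorphic_on - {1}"
  and riemann_zeta_eq_dirichlet_zeta: "Re s > 1 \<Longrightarrow> riemann_zeta s = dirichlet_zeta s"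
proof -
  obtain f where f: "f holomorphic_on - {1}" "\<And>s. Re s > 1 \<Longrightarrow> f s = dirichlet_zeta s"
    using zeta_continuation by blast
  have "(\<lambda>m. of_nat (Suc m) powr (- s)) sums f s" if "Re s > 1" for s
    using summable_sums[OF summable_dirichlet[OF that]] f(2)[OF that] by (simp add: dirichlet_zeta_def)
  with f(1) have "\<exists>f. f holomorphic_on - {1} \<and>
      (\<forall>s. Re s > 1 \<longrightarrow> (\<lambda>m. of_nat (Suc m) powr (- s) :: complex) sums f s)" by blast
  from someI_ex[OF this, folded riemann_zeta_def]
  show "riemann_zeta holomorphic_on - {1}" "Re s > 1 \<Longrightarrow> riemann_zeta s = dirichlet_zeta s"
    by (auto simp: dirichlet_zeta_def sums_unique)
qed

text \<open>This is (s - 1) \<zeta>(s) on Re s > 0, with the pole at 1 removed. The order-one Taylor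
  series is chosen because it comes with an explicit bound.\<close>

definition regularized_zeta :: "complex \<Rightarrow> complex" where
  "regularized_zeta s = 1 + (\<Sum>n. taylor_term 1 n s)"

lemma regularized_zeta_holomorphic: "regularized_zeta holomorphic_on {s. Re s > 0}"
  using taylor_series_holomorphic(1)[of 1] unfolding regularized_zeta_def[abs_def]
  by (intro holomorphic_intros) auto

lemma regularized_zeta_eq:
  assumes "Re s > 0" "s \<noteq> 1"
  shows "regularized_zeta s = (s - 1) * riemann_zeta s"
proof (rule analytic_continuation_open[of "{s. Re s > 1}" "{s. Re s > 0} - {1}" regularized_zeta
    "\<lambda>s. (s - 1) * riemann_zeta s"])
  have "2 \<in> {s. Re s > 1}" by simp
  then show "{s. Re s > 1} \<noteq> {}" by blast
  show "connected ({s. Re s > 0} - {1 :: complex})"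
    by (rule connected_open_delete) (auto intro: open_Re_gt connected_Re_gt)
  show "open ({s. Re s > 0} - {1 :: complex})"
    using open_Re_gt by (rule open_delete)
  show "regularized_zeta holomorphic_on {s. Re s > 0} - {1}"
    using regularized_zeta_holomorphic by (rule holomorphic_on_subset) auto
  show "(\<lambda>s. (s - 1) * riemann_zeta s) holomorphic_on {s. Re s > 0} - {1}"
    by (intro holomorphic_intros holomorphic_on_subset[OF riemann_zeta_holomorphic]) auto
  show "regularized_zeta z = (z - 1) * riemann_zeta z" if "z \<in> {s. Re s > 1}" for z
    using that taylor_series_dirichlet[of z 1]
    by (simp add: regularized_zeta_def riemann_zeta_eq_dirichlet_zeta)
qed (use assms open_Re_gt in auto)

text \<open>The order-one remainder carries the factor 2 |C(1-s, 2)| = |s| |s - 1|, and for Re s >=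
  1/10 the remaining powers are dominated by (n+1)^(-11/10), whose sum is C.\<close>

lemma regularized_zeta_upper_bound:
  obtains C where "C \<ge> 0" "\<And>s. Re s \<ge> 1/10 \<Longrightarrow> norm (regularized_zeta s) \<le> 1 + C * (norm s * norm (s - 1))"
proof
  let ?h = "\<lambda>n. real (Suc n) powr (-11/10)"
  have sm: "summable ?h" by (rule summable_Suc_powr) simp
  show "suminf ?h \<ge> 0" by (rule suminf_nonneg[OF sm]) auto
  fix s :: complex assume s: "Re s \<ge> 1/10"
  have "2 * norm ((1 - s) gchoose 2) = norm s * norm (s - 1)"
  proof -
    have "2 * ((1 - s) gchoose 2) = s * (s - 1)"
      using gbinomial_Suc_mult[of 1 "1 - s"] by (simp add: numeral_2_eq_2 algebra_simps)
    from arg_cong[OF this, of norm] show ?thesis by (simp add: norm_mult)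
  qed
  moreover have "norm (taylor_term 1 n s) \<le>
      2 * norm ((1 - s) gchoose 2) * real (Suc n) powr (- Re s - 1)" for n
    using norm_taylor_term_le[where N = 1 and s = s] s by (simp add: numeral_2_eq_2)
  ultimately have "norm (taylor_term 1 n s) \<le> (norm s * norm (s - 1)) * real (Suc n) powr (- Re s - 1)" for n
    by simp
  moreover have "(norm s * norm (s - 1)) * real (Suc n) powr (- Re s - 1) \<le> (norm s * norm (s - 1)) * ?h n" for n
    using s by (intro mult_left_mono powr_mono) auto
  ultimately have "norm (\<Sum>n. taylor_term 1 n s) \<le> (\<Sum>n. (norm s * norm (s - 1)) * ?h n)"
    by (intro norm_suminf_le summable_mult sm) (meson order_trans)
  also have "\<dots> = suminf ?h * (norm s * norm (s - 1))" using suminf_mult[OF sm] by (simp add: mult.commute)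
  finally show "norm (regularized_zeta s) \<le> 1 + suminf ?h * (norm s * norm (s - 1))"
    unfolding regularized_zeta_def using norm_triangle_ineq[of 1 "\<Sum>n. taylor_term 1 n s"] by simp
qed

text \<open>On this line \<zeta>(s) differs from 1 by at most \<zeta>(2) - 1 = pi^2/6 - 1 <= 7/10,
  and |s - 1| >= 1.\<close>

lemma regularized_zeta_lower_bound:
  assumes "Re s = 2"
  shows "norm (regularized_zeta s) \<ge> 3/10"
proof -
  let ?f = "\<lambda>m. of_nat (Suc m) powr (- s) :: complex"
  have sm: "summable ?f" using assms by (intro summable_dirichlet) auto
  have sq: "(\<lambda>n. 1 / (real n + 1)\<^sup>2) sums (pi\<^sup>2 / 6)" using inverse_squares_sums by (simp add: add.commute)
  have eq: "norm (?f (Suc m)) = 1 / (real (Suc m) + 1)\<^sup>2" for m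
  proof -
    have "norm (?f (Suc m)) = real (Suc (Suc m)) powr (- 2)"
      using assms by (subst norm_powr_real_powr) auto
    also have "\<dots> = 1 / (real (Suc m) + 1)\<^sup>2"
      by (simp add: powr_minus divide_inverse add.commute)
    finally show ?thesis .
  qed
  have sm': "summable (\<lambda>m. 1 / (real (Suc m) + 1)\<^sup>2)"
    using sums_summable[OF sq] summable_Suc_iff[of "\<lambda>n. 1 / (real n + 1)\<^sup>2"] by simp
  have "norm (\<Sum>m. ?f (Suc m)) \<le> (\<Sum>m. 1 / (real (Suc m) + 1)\<^sup>2)"
    by (intro norm_suminf_le sm') (simp only: eq)
  also have "\<dots> = pi\<^sup>2 / 6 - 1"
    using suminf_split_head[OF sums_summable[OF sq]] sums_unique[OF sq] by simp
  also have "\<dots> \<le> 7/10"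
  proof -
    have "pi \<le> 63/20" using pi_approx by simp
    then have "pi * pi \<le> (63/20) * (63/20)" by (intro mult_mono) auto
    then show ?thesis by (simp add: power2_eq_square)
  qed
  finally have 1: "norm (\<Sum>m. ?f (Suc m)) \<le> 7/10" .
  have "riemann_zeta s = 1 + (\<Sum>m. ?f (Suc m))"
    using suminf_split_head[OF sm] assms
    by (simp add: riemann_zeta_eq_dirichlet_zeta dirichlet_zeta_def)
  then have "norm (riemann_zeta s) \<ge> 3/10"
    using 1 norm_diff_ineq[of 1 "\<Sum>m. ?f (Suc m)"] by simp
  moreover have "norm (s - 1) \<ge> 1" using abs_Re_le_cmod[of "s - 1"] assms by simp
  ultimately have "1 * (3/10) \<le> norm (s - 1) * norm (riemann_zeta s)" by (intro mult_mono) auto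
  moreover have "s \<noteq> 1" using assms by auto
  ultimately show ?thesis using assms regularized_zeta_eq[of s] by (simp add: norm_mult)
qed

lemma regularized_zeta_not_zero: "\<exists>w\<in>{s. Re s > 0}. regularized_zeta w \<noteq> 0"
  using regularized_zeta_lower_bound[of 2] by (intro bexI[of _ 2]) auto

text \<open>The box lies in the disc of radius 8/5 about 2 + iT, as (3/2)^2 + (1/2)^2 < (8/5)^2, and
  the circle of radius 19/10 stays in Re s >= 1/10, where the quadratic bound holds. Jensen gives a
  logarithmic count, weakened to a square root.\<close>

lemma count_zeros_unit_box:
  obtains K where "K \<ge> 0"
    "\<And>T I (\<rho> :: 'i \<Rightarrow> complex). finite I \<Longrightarrow>
      (\<And>i. i \<in> I \<Longrightarrow> 1/2 \<le> Re (\<rho> i) \<and> Re (\<rho> i) \<le> 1 \<and> \<bar>Im (\<rho> i) - T\<bar> \<le> 1/2) \<Longrightarrow>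
      (\<And>z. Re z > 0 \<Longrightarrow> int (card {i \<in> I. \<rho> i = z}) \<le> zorder regularized_zeta z) \<Longrightarrow>
      real (card I) \<le> K * sqrt (4 + \<bar>T\<bar>)"
proof -
  obtain C where C: "C \<ge> 0" "\<And>s. Re s \<ge> 1/10 \<Longrightarrow> norm (regularized_zeta s) \<le> 1 + C * (norm s * norm (s - 1))"
    using regularized_zeta_upper_bound by blast
  \<comment> \<open>The factor 10/3 divides out the lower bound 3/10 at the centre.\<close>
  define A where "A = (1 + C) * (10/3)"
  define q :: real where "q = (19/10) / (8/5)"
  have A: "A > 0" using C unfolding A_def by simp
  have q: "q > 1" unfolding q_def by simp
  define K where "K = (\<bar>ln A\<bar> + 4) / ln q"
  show ?thesis
  proof (rule that)
    show "K \<ge> 0" using q unfolding K_def by simp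
  next
    fix T :: real and I and \<rho> :: "'i \<Rightarrow> complex"
    assume I: "finite I"
      and \<rho>: "\<And>i. i \<in> I \<Longrightarrow> 1/2 \<le> Re (\<rho> i) \<and> Re (\<rho> i) \<le> 1 \<and> \<bar>Im (\<rho> i) - T\<bar> \<le> 1/2"
      and ord: "\<And>z. Re z > 0 \<Longrightarrow> int (card {i \<in> I. \<rho> i = z}) \<le> zorder regularized_zeta z"
    define z where "z = Complex 2 T"
    \<comment> \<open>On the circle |s| and |s - 1| are at most (2 + |T|) + 19/10 < v.\<close>
    define v where "v = 4 + \<bar>T\<bar>"
    have v: "v \<ge> 4" unfolding v_def by simp
    have low: "norm (regularized_zeta z) \<ge> 3/10"
      by (rule regularized_zeta_lower_bound) (simp add: z_def)
    have nz: "norm z \<le> 2 + \<bar>T\<bar>" using cmod_le[of z] by (simp add: z_def)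
    have close: "Re s \<ge> 1/10" if "dist z s \<le> 19/10" for s
      using abs_Re_le_cmod[of "z - s"] that by (simp add: dist_norm z_def)
    have "norm (regularized_zeta z) * ((19/10) / (8/5)) ^ card I \<le> (1 + C) * v\<^sup>2"
    proof (rule jensen_zero_count[OF I, of "{s. Re s > 0}" regularized_zeta z "19/10" "8/5" \<rho>])
      show "open {s. Re s > 0}" "connected {s. Re s > 0}" by (rule open_Re_gt connected_Re_gt)+
      show "regularized_zeta holomorphic_on {s. Re s > 0}" by (rule regularized_zeta_holomorphic)
      show "cball z (19/10) \<subseteq> {s. Re s > 0}" using close by fastforce
      show "regularized_zeta z \<noteq> 0" using low by auto
    next
      fix i assume "i \<in> I"
      from \<rho>[OF this] have "\<bar>Re (z - \<rho> i)\<bar> \<le> 3/2" "\<bar>Im (z - \<rho> i)\<bar> \<le> 1/2"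
        by (auto simp: z_def abs_if split: if_splits)
      then have "(Re (z - \<rho> i))\<^sup>2 \<le> (3/2)\<^sup>2" "(Im (z - \<rho> i))\<^sup>2 \<le> (1/2)\<^sup>2"
        by (subst abs_le_square_iff[symmetric], simp)+
      then have "(norm (z - \<rho> i))\<^sup>2 \<le> (8/5)\<^sup>2" unfolding cmod_power2 by (simp add: power2_eq_square)
      then show "dist z (\<rho> i) \<le> 8/5" unfolding dist_norm by (rule power2_le_imp_le) simp
    next
      fix s assume s: "dist z s = 19/10"
      have "norm s \<le> v" "norm (s - 1) \<le> v"
        using norm_triangle_ineq4[of z "z - s"] norm_triangle_ineq4[of "z - 1" "z - s"]
          cmod_le[of "z - 1"] nz s by (auto simp: dist_norm v_def z_def)
      then have "norm s * norm (s - 1) \<le> v\<^sup>2" unfolding power2_eq_square using v by (intro mult_mono) auto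
      then have "C * (norm s * norm (s - 1)) \<le> C * v\<^sup>2" using C by (intro mult_left_mono) auto
      moreover have "1 \<le> v\<^sup>2" using v by (simp add: one_le_power)
      ultimately show "norm (regularized_zeta s) \<le> (1 + C) * v\<^sup>2"
        using C(2)[OF close[of s]] s by (simp add: algebra_simps)
    qed (use ord in auto)
    moreover have "3/10 * q ^ card I \<le> norm (regularized_zeta z) * q ^ card I"
      using low q by (intro mult_right_mono) auto
    ultimately have "3/10 * q ^ card I \<le> (1 + C) * v\<^sup>2" unfolding q_def by linarith
    then have "q ^ card I \<le> A * v\<^sup>2" unfolding A_def by (simp add: field_simps)
    then have "ln (q ^ card I) \<le> ln (A * v\<^sup>2)" using q A v by (subst ln_le_cancel_iff) auto
    then have "real (card I) * ln q \<le> ln A + 2 * ln v"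
      using q A v by (simp add: ln_realpow ln_mult)
    \<comment> \<open>Here ln x <= x at x = sqrt v replaces the logarithm by a square root, and sqrt
      v >= 1 absorbs the constant ln A.\<close>
    also have "2 * ln v = 4 * ln (sqrt v)" using v by (simp add: ln_sqrt)
    also have "ln (sqrt v) \<le> sqrt v" using v ln_le_minus_one[of "sqrt v"] by simp
    also have "ln A \<le> \<bar>ln A\<bar> * sqrt v"
      using v mult_left_mono[of 1 "sqrt v" "\<bar>ln A\<bar>"] abs_ge_self[of "ln A"] by simp
    finally have "real (card I) * ln q \<le> (\<bar>ln A\<bar> + 4) * sqrt v" by (simp add: algebra_simps)
    then show "real (card I) \<le> K * sqrt (4 + \<bar>T\<bar>)"
      using q unfolding K_def v_def by (simp add: field_simps)
  qed
qed

section \<open>Multiplicities of the listed zeros as orders of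
  \<open>regularized_zeta\<close>\<close>

lemma zorder_regularized_zeta_nonneg:
  assumes "Re z > 0"
  shows "zorder regularized_zeta z \<ge> 0"
  using zorder_exist_zero[OF regularized_zeta_holomorphic open_Re_gt connected_Re_gt _ regularized_zeta_not_zero, of z] assms
  by (auto split: if_splits)

text \<open>The factor s - 1 has order 0 at z, so the multiplicities in the listing carry over to
  the pole-free function used in the Jensen count.\<close>

lemma zorder_regularized_zeta_eq:
  assumes "Re z > 0" "z \<noteq> 1"
  shows "zorder regularized_zeta z = zorder riemann_zeta z"
proof -
  have S: "open ({s. Re s > 0} - {1 :: complex})" using open_Re_gt by (rule open_delete)
  have zS: "z \<in> {s. Re s > 0} - {1}" using assms by auto
  have eq: "\<forall>\<^sub>F s in at z. regularized_zeta s = (s - 1) * riemann_zeta s"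
    using eventually_at_in_open'[OF S zS] by eventually_elim (auto intro!: regularized_zeta_eq)
  have "zorder regularized_zeta z = zorder (\<lambda>s. (s - 1) * riemann_zeta s) z"
    by (rule zorder_cong[OF eq refl])
  also have "\<dots> = zorder (\<lambda>s. s - 1) z + zorder riemann_zeta z"
  proof (rule zorder_times_analytic)
    show "riemann_zeta analytic_on {z}"
      using riemann_zeta_holomorphic assms analytic_at[of riemann_zeta z] by blast
    obtain w where w: "w \<in> {s. Re s > 0}" "regularized_zeta w \<noteq> 0" using regularized_zeta_not_zero by blast
    have "\<forall>\<^sub>F s in at z. regularized_zeta s \<noteq> 0 \<and> s \<in> {s. Re s > 0}"
      using non_zero_neighbour_alt[OF regularized_zeta_holomorphic open_Re_gt connected_Re_gt _ w] assms by auto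
    then show "\<forall>\<^sub>F s in at z. (s - 1) * riemann_zeta s \<noteq> 0" using eq by eventually_elim auto
  qed (auto intro!: analytic_intros)
  also have "zorder (\<lambda>s. s - 1) z = 0" using assms by (auto intro!: zorder_eq_0I analytic_intros)
  finally show ?thesis by simp
qed

text \<open>With one sign chosen per index, sending k to \<open>(k, e k)\<close> maps the selected
  indices injectively into the pairs that the listing counts.\<close>

lemma zero_listing_multiplicity:
  assumes \<tau>: "zeta_zero_listing \<tau>" and I: "finite I" and e: "\<And>k. e k = 1 \<or> e k = -1"
    and z: "Re z > 0"
  shows "int (card {k \<in> I. 1/2 + e k * \<i> * \<tau> k = z}) \<le> zorder regularized_zeta z"
proof (cases "{k \<in> I. 1/2 + e k * \<i> * \<tau> k = z} = {}")
  case True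
  then show ?thesis using zorder_regularized_zeta_nonneg[OF z] by (simp only: card.empty of_nat_0)
next
  case False
  then obtain k where "1/2 + e k * \<i> * \<tau> k = z" by blast
  then have zero: "nontrivial_zeta_zero z"
    using \<tau> e[of k] unfolding zeta_zero_listing_def by auto
  then have z1: "z \<noteq> 1" and "riemann_zeta z = 0" by (auto simp: nontrivial_zeta_zero_def)
  let ?P = "{(k, \<epsilon>). \<epsilon> \<in> {1, -1} \<and> 1/2 + \<epsilon> * \<i> * \<tau> k = z}"
  have P: "zorder regularized_zeta z = int (card ?P)"
    using \<tau> zero zorder_regularized_zeta_eq[OF z z1] unfolding zeta_zero_listing_def by auto
  have "regularized_zeta z = 0" using regularized_zeta_eq[OF z z1] \<open>riemann_zeta z = 0\<close> by simp
  then have "zorder regularized_zeta z > 0"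
    using zorder_exist_zero[OF regularized_zeta_holomorphic open_Re_gt connected_Re_gt _ regularized_zeta_not_zero, of z] z
    by (auto split: if_splits)
  \<comment> \<open>A positive \<open>card\<close> excludes the default value 0 of an infinite set,
    so \<open>?P\<close> is finite.\<close>
  then have "card ?P > 0" unfolding P by (simp only: of_nat_0_less_iff)
  then have "finite ?P" by (rule card_ge_0_finite)
  then have "card {k \<in> I. 1/2 + e k * \<i> * \<tau> k = z} \<le> card ?P"
    by (intro card_inj_on_le[of "\<lambda>k. (k, e k)"]) (use e in \<open>auto simp: inj_on_def\<close>)
  then show ?thesis unfolding P by simp
qed

section \<open>Summation over the zeros\<close>

text \<open>A selected zero has imaginary part Re \<tau> or -Re \<tau>, so indices with Re \<tau> in
  [m, m+1) fall into two unit boxes, at heights m + 1/2 and -(m + 1/2).\<close>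

lemma zero_listing_box_count:
  assumes \<tau>: "zeta_zero_listing \<tau>"
  obtains K where "K \<ge> 0"
    "\<And>F m. finite F \<Longrightarrow> real (card {k \<in> F. nat \<lfloor>Re (\<tau> k)\<rfloor> = m}) \<le> K * sqrt (real m + 1)"
proof -
  obtain K where K: "K \<ge> 0"
    "\<And>T I (\<rho> :: nat \<Rightarrow> complex). finite I \<Longrightarrow>
      (\<And>i. i \<in> I \<Longrightarrow> 1/2 \<le> Re (\<rho> i) \<and> Re (\<rho> i) \<le> 1 \<and> \<bar>Im (\<rho> i) - T\<bar> \<le> 1/2) \<Longrightarrow>
      (\<And>z. Re z > 0 \<Longrightarrow> int (card {i \<in> I. \<rho> i = z}) \<le> zorder regularized_zeta z) \<Longrightarrow>
      real (card I) \<le> K * sqrt (4 + \<bar>T\<bar>)"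
    using count_zeros_unit_box by blast
  \<comment> \<open>In each pair select the zero with real part at least 1/2: the count then only needs \<open>\<zeta>\<close> for
    \<open>Re s > 0\<close>, and the functional equation is avoided.\<close>
  define e :: "nat \<Rightarrow> complex" where "e k = (if Im (\<tau> k) \<le> 0 then 1 else - 1)" for k
  define \<rho> where "\<rho> k = 1/2 + e k * \<i> * \<tau> k" for k
  have e: "e k = 1 \<or> e k = -1" for k unfolding e_def by auto
  have pos: "Re (\<tau> k) > 0" for k using \<tau> unfolding zeta_zero_listing_def by blast
  have half: "1/2 \<le> Re (\<rho> k)" for k unfolding \<rho>_def e_def by auto
  have one: "Re (\<rho> k) \<le> 1" for k
  proof -
    have "nontrivial_zeta_zero (\<rho> k)"
      using \<tau> e[of k] unfolding zeta_zero_listing_def \<rho>_def by auto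
    then show ?thesis unfolding nontrivial_zeta_zero_def by simp
  qed
  show ?thesis
  proof (rule that)
    \<comment> \<open>The 2 counts the signs; the 3 comes from sqrt (m + 9/2) <= 3 sqrt (m +
      1).\<close>
    show "2 * (3 * K) \<ge> 0" using K by simp
    fix F :: "nat set" and m :: nat assume F: "finite F"
    define I where "I = {k \<in> F. nat \<lfloor>Re (\<tau> k)\<rfloor> = m}"
    have sq: "sqrt (4 + (real m + 1/2)) \<le> 3 * sqrt (real m + 1)"
    proof -
      have "sqrt (4 + (real m + 1/2)) \<le> sqrt (3\<^sup>2 * (real m + 1))" by (intro real_sqrt_le_mono) simp
      also have "\<dots> = 3 * sqrt (real m + 1)" by (subst real_sqrt_mult) simp
      finally show ?thesis .
    qed
    have "real (card {k \<in> I. e k = c}) \<le> 3 * K * sqrt (real m + 1)" if c: "c = 1 \<or> c = -1" for c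
    proof -
      define T where "T = Re c * (real m + 1/2)"
      have "real (card {k \<in> I. e k = c}) \<le> K * sqrt (4 + \<bar>T\<bar>)"
      proof (rule K(2)[of _ \<rho>])
        show "finite {k \<in> I. e k = c}" using F unfolding I_def by simp
      next
        fix k assume k: "k \<in> {k \<in> I. e k = c}"
        then have "real m \<le> Re (\<tau> k)" "Re (\<tau> k) \<le> real m + 1"
          using pos[of k] unfolding I_def by (auto intro: less_imp_le)
        moreover have "Im (\<rho> k) = Re c * Re (\<tau> k)" using k c unfolding \<rho>_def by auto
        ultimately have "\<bar>Im (\<rho> k) - T\<bar> = \<bar>Re (\<tau> k) - (real m + 1/2)\<bar>" and
          "\<bar>Re (\<tau> k) - (real m + 1/2)\<bar> \<le> 1/2"
          using c unfolding T_def by (auto simp: abs_if)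
        then show "1/2 \<le> Re (\<rho> k) \<and> Re (\<rho> k) \<le> 1 \<and> \<bar>Im (\<rho> k) - T\<bar> \<le> 1/2"
          using half one by simp
      next
        fix z :: complex assume "Re z > 0"
        then show "int (card {i \<in> {k \<in> I. e k = c}. \<rho> i = z}) \<le> zorder regularized_zeta z"
          unfolding \<rho>_def using F e by (intro zero_listing_multiplicity[OF \<tau>]) (auto simp: I_def)
      qed
      also have "\<bar>T\<bar> = real m + 1/2" using c unfolding T_def by auto
      also have "K * sqrt (4 + (real m + 1/2)) \<le> K * (3 * sqrt (real m + 1))"
        using K(1) sq by (intro mult_left_mono)
      finally show ?thesis by simp
    qed
    from this[of 1] this[of "-1"]
    have "real (card {k \<in> I. e k = 1}) + real (card {k \<in> I. e k = -1}) \<le> 2 * (3 * K) * sqrt (real m + 1)" by simp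
    moreover have "card I \<le> card {k \<in> I. e k = 1} + card {k \<in> I. e k = -1}"
    proof -
      have "I = {k \<in> I. e k = 1} \<union> {k \<in> I. e k = -1}" using e by blast
      from arg_cong[OF this, of card] show ?thesis using card_Un_le by (rule ord_eq_le_trans)
    qed
    ultimately show "real (card {k \<in> F. nat \<lfloor>Re (\<tau> k)\<rfloor> = m}) \<le> 2 * (3 * K) * sqrt (real m + 1)"
      unfolding I_def[symmetric] by linarith
  qed
qed

text \<open>Grouped by the integer part m of Re \<tau>, O(sqrt (m+1)) indices contribute at most 2 /
  (m+1)^2 each, in total O((m+1)^(-3/2)).\<close>

lemma summable_inverse_square_ordinates:
  assumes \<tau>: "zeta_zero_listing \<tau>"
  shows "summable (\<lambda>k. 1 / (1 + (Re (\<tau> k))\<^sup>2))"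
proof -
  obtain K where K: "K \<ge> 0"
    "\<And>F m. finite F \<Longrightarrow> real (card {k \<in> F. nat \<lfloor>Re (\<tau> k)\<rfloor> = m}) \<le> K * sqrt (real m + 1)"
    using zero_listing_box_count[OF \<tau>] by blast
  have pos: "Re (\<tau> k) > 0" for k using \<tau> unfolding zeta_zero_listing_def by blast
  let ?h = "\<lambda>m. (2 * K) * real (Suc m) powr (-3/2)"
  have sm: "summable ?h" by (intro summable_mult summable_Suc_powr) simp
  have box: "(\<Sum>k\<in>{k \<in> F. nat \<lfloor>Re (\<tau> k)\<rfloor> = m}. 1 / (1 + (Re (\<tau> k))\<^sup>2)) \<le> ?h m" if F: "finite F" for F m
  proof -
    define u where "u = real m + 1"
    have u: "u > 0" unfolding u_def by simp
    have "(\<Sum>k\<in>{k \<in> F. nat \<lfloor>Re (\<tau> k)\<rfloor> = m}. 1 / (1 + (Re (\<tau> k))\<^sup>2)) \<le>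
       of_nat (card {k \<in> F. nat \<lfloor>Re (\<tau> k)\<rfloor> = m}) * (2 / u\<^sup>2)"
    proof (rule sum_bounded_above)
      fix k assume "k \<in> {k \<in> F. nat \<lfloor>Re (\<tau> k)\<rfloor> = m}"
      then have "real m \<le> Re (\<tau> k)" using pos[of k] by auto
      then have "2 * (1 + (real m)\<^sup>2) \<le> 2 * (1 + (Re (\<tau> k))\<^sup>2)"
        by (intro mult_left_mono add_left_mono power_mono) auto
      \<comment> \<open>Equivalent to (m - 1)^2 >= 0.\<close>
      moreover have "u\<^sup>2 \<le> 2 * (1 + (real m)\<^sup>2)"
        using zero_le_power2[of "real m - 1"] unfolding u_def by (simp add: power2_eq_square algebra_simps)
      ultimately have "u\<^sup>2 \<le> 2 * (1 + (Re (\<tau> k))\<^sup>2)" by (rule order_trans[rotated])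
      moreover have "1 + (Re (\<tau> k))\<^sup>2 > 0" by (simp add: add_pos_nonneg)
      ultimately show "1 / (1 + (Re (\<tau> k))\<^sup>2) \<le> 2 / u\<^sup>2" using u by (simp add: divide_simps)
    qed
    also have "\<dots> \<le> (K * sqrt u) * (2 / u\<^sup>2)"
      using K(2)[OF F] u unfolding u_def by (intro mult_right_mono) auto
    also have "\<dots> = 2 * K * (u powr (1/2) * u powr (-2))"
    proof -
      have "u powr (1/2) = sqrt u" using u by (intro powr_half_sqrt) simp
      moreover have "u powr (-2) = 1 / u\<^sup>2" using u by (simp add: powr_minus inverse_eq_divide)
      ultimately show ?thesis by simp
    qed
    also have "\<dots> = ?h m" unfolding powr_add[symmetric] by (simp add: u_def add.commute)
    finally show ?thesis .
  qed
  show ?thesis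
  proof (rule summableI_nonneg_bounded)
    show "1 / (1 + (Re (\<tau> k))\<^sup>2) \<ge> 0" for k by simp
    fix n
    let ?b = "\<lambda>k. nat \<lfloor>Re (\<tau> k)\<rfloor>"
    have "(\<Sum>k<n. 1 / (1 + (Re (\<tau> k))\<^sup>2)) =
        (\<Sum>m\<in>?b ` {..<n}. \<Sum>k\<in>{k \<in> {..<n}. ?b k = m}. 1 / (1 + (Re (\<tau> k))\<^sup>2))"
      by (rule sum.image_gen) simp
    also have "\<dots> \<le> (\<Sum>m\<in>?b ` {..<n}. ?h m)" by (intro sum_mono box) simp
    also have "\<dots> \<le> suminf ?h" using sm K by (intro sum_le_suminf) auto
    finally show "(\<Sum>k<n. 1 / (1 + (Re (\<tau> k))\<^sup>2)) \<le> suminf ?h" .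
  qed
qed

text \<open>In the factorization \<open>(1/2 + \<i> * t) * (1/2 - \<i> * t)\<close> both factors
  have imaginary part of modulus |Re t|.\<close>

lemma norm_zero_pair_ge:
  fixes t :: complex
  shows "(Re t)\<^sup>2 \<le> norm (1/4 + t\<^sup>2)"
proof -
  have "1/4 + t\<^sup>2 = (1/2 + \<i> * t) * (1/2 - \<i> * t)"
    by (simp add: algebra_simps power2_eq_square)
  moreover have "\<bar>Re t\<bar> \<le> norm (1/2 + \<i> * t)" "\<bar>Re t\<bar> \<le> norm (1/2 - \<i> * t)"
    using abs_Im_le_cmod[of "1/2 + \<i> * t"] abs_Im_le_cmod[of "1/2 - \<i> * t"] by auto
  ultimately have "\<bar>Re t\<bar> * \<bar>Re t\<bar> \<le> norm (1/4 + t\<^sup>2)"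
    by (simp only: norm_mult) (intro mult_mono, auto)
  then show ?thesis by (simp add: power2_eq_square)
qed

text \<open>By monotonicity every \<open>Re (\<tau> k)\<close> is at least t =
  \<open>Re (\<tau> 0)\<close> > 0, so 1/|x_k| is at most 1/t^2 and powers j > 1 reduce to j =
  1.\<close>

lemma summable_secondary_zeta:
  assumes \<tau>: "zeta_zero_listing \<tau>" and j: "j \<ge> 1"
  shows "summable (\<lambda>k. (1 / (1/4 + (\<tau> k)\<^sup>2)) ^ j)"
proof -
  define t where "t = Re (\<tau> 0)"
  have pos: "Re (\<tau> k) > 0" for k using \<tau> unfolding zeta_zero_listing_def by blast
  have mono: "t \<le> Re (\<tau> k)" for k
    using \<tau> unfolding zeta_zero_listing_def mono_def t_def by blast
  have t: "t > 0" unfolding t_def by (rule pos)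
  \<comment> \<open>Replacing 1 / r by 1 / (1 + r) costs the factor 1 / r + 1, at most 1 / t^2 + 1
    below.\<close>
  have recip: "1 / r = (1 / r + 1) * (1 / (1 + r))" if "r > 0" for r :: real
    using that by (simp add: divide_simps)
  show ?thesis
  proof (rule summable_comparison_test')
    show "summable (\<lambda>k. ((1 / t\<^sup>2) ^ (j - 1) * (1 / t\<^sup>2 + 1)) * (1 / (1 + (Re (\<tau> k))\<^sup>2)))"
      by (intro summable_mult summable_inverse_square_ordinates \<tau>)
  next
    fix k
    let ?x = "norm (1/4 + (\<tau> k)\<^sup>2)" and ?r = "(Re (\<tau> k))\<^sup>2"
    have r: "?r \<ge> t\<^sup>2" using mono[of k] t by (intro power_mono) auto
    have t2: "t\<^sup>2 > 0" using t by simp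
    have x: "?x \<ge> ?r" by (rule norm_zero_pair_ge)
    have r0: "?r > 0" using less_le_trans[OF t2 r] .
    have x0: "?x > 0" using less_le_trans[OF r0 x] .
    have a: "1 / ?x \<le> 1 / t\<^sup>2"
      using order_trans[OF r x] x0 t2 by (intro divide_left_mono mult_pos_pos) auto
    have "1 / ?x \<le> 1 / ?r" using x x0 r0 by (intro divide_left_mono mult_pos_pos) auto
    also have "1 / ?r = (1 / ?r + 1) * (1 / (1 + ?r))"
      using r0 by (rule recip)
    also have "\<dots> \<le> (1 / t\<^sup>2 + 1) * (1 / (1 + ?r))"
      using r r0 t2 by (intro mult_right_mono add_mono divide_left_mono mult_pos_pos) auto
    finally have b: "1 / ?x \<le> (1 / t\<^sup>2 + 1) * (1 / (1 + ?r))" .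
    have "norm ((1 / (1/4 + (\<tau> k)\<^sup>2)) ^ j) = (1 / ?x) ^ (j - 1) * (1 / ?x)"
      using j by (cases j) (auto simp: norm_power norm_divide)
    also have "\<dots> \<le> (1 / t\<^sup>2) ^ (j - 1) * ((1 / t\<^sup>2 + 1) * (1 / (1 + ?r)))"
      using a b by (intro mult_mono power_mono) auto
    finally show "norm ((1 / (1/4 + (\<tau> k)\<^sup>2)) ^ j) \<le> ((1 / t\<^sup>2) ^ (j - 1) * (1 / t\<^sup>2 + 1)) * (1 / (1 + ?r))"
      by (simp only: mult.assoc)
  qed
qed

theorem mainTheorem1:
  fixes \<tau> :: "nat \<Rightarrow> complex" and n :: nat
  assumes "zeta_zero_listing \<tau>"
    and "n \<ge> 1"
  shows "li_coeff \<tau> n =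
    - of_nat n * (\<Sum>j=1..n. (-1) ^ j / of_nat j * of_nat ((n + j - 1) choose (2 * j - 1)) *
        secondary_zeta \<tau> (of_nat j))"
proof -
  let ?x = "\<lambda>k. 1/4 + (\<tau> k)\<^sup>2"
  let ?c = "\<lambda>j. (-1) ^ j / of_nat j * of_nat ((n + j - 1) choose (2 * j - 1)) :: complex"
  have zero: "nontrivial_zeta_zero (1/2 + \<i> * \<tau> k)" for k
    using assms(1) unfolding zeta_zero_listing_def by blast
  \<comment> \<open>Nontrivial zeros lie strictly inside the strip, so the Li summands involve no
    division by zero and x_k is nonzero.\<close>
  have ne: "1/2 + \<i> * \<tau> k \<noteq> 0" "1/2 + \<i> * \<tau> k \<noteq> 1" for k
    using zero[of k] unfolding nontrivial_zeta_zero_def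
    by (metis less_irrefl zero_complex.sel(1), metis less_irrefl one_complex.sel(1))
  have x: "?x k = (1/2 + \<i> * \<tau> k) * (1 - (1/2 + \<i> * \<tau> k))" for k
    by (simp add: algebra_simps power2_eq_square)
  have x0: "?x k \<noteq> 0" for k
    using ne(1)[of k] ne(2)[of k, symmetric] unfolding x mult_eq_0_iff right_minus_eq by blast
  have Z: "secondary_zeta \<tau> (of_nat j) = (\<Sum>k. (1 / ?x k) ^ j)" for j
    unfolding secondary_zeta_def using x0 by (simp add: powr_minus power_one_over inverse_eq_divide)
  have "li_coeff \<tau> n = (\<Sum>k. \<Sum>j=1..n. - of_nat n * (?c j * (1 / ?x k) ^ j))"
  proof -
    have "(1 - (1 - 1 / (1/2 + \<i> * \<tau> k)) ^ n) + (1 - (1 - 1 / (1/2 - \<i> * \<tau> k)) ^ n) =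
      (\<Sum>j=1..n. - of_nat n * (?c j * (1 / ?x k) ^ j))" for k
      using li_term_eq[OF ne assms(2), of k] unfolding x[symmetric] by (simp add: algebra_simps)
    then show ?thesis unfolding li_coeff_def by simp
  qed
  \<comment> \<open>Every inner series converges because j >= 1, so the finite sum can be moved
    outside.\<close>
  also have "\<dots> = (\<Sum>j=1..n. \<Sum>k. - of_nat n * (?c j * (1 / ?x k) ^ j))"
    by (intro suminf_sum summable_mult summable_secondary_zeta assms(1)) auto
  also have "\<dots> = (\<Sum>j=1..n. - of_nat n * (?c j * secondary_zeta \<tau> (of_nat j)))"
  proof (rule sum.cong)
    fix j assume "j \<in> {1..n}"
    then have "summable (\<lambda>k. (1 / ?x k) ^ j)" by (intro summable_secondary_zeta assms(1)) auto
    then show "(\<Sum>k. - of_nat n * (?c j * (1 / ?x k) ^ j)) = - of_nat n * (?c j * secondary_zeta \<tau> (of_nat j))"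
      unfolding Z by (simp only: suminf_mult summable_mult)
  qed simp
  finally show ?thesis by (simp only: sum_distrib_left)
qed

end
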